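(* Let $(H,\Delta,\epsilon,\Phi,S,\alpha,\beta)$ be a quasi-triangular quasi-Hopf algebra with bijective antipode and $R$-matrix $\mathcal{R}$, and let $\tilde{\mathcal{R}}=(\mathcal{R}^T)^{-1}$. Let $u$ and $\tilde u$ be the $u$-operators associated with $\mathcal{R}$ and $\tilde{\mathcal{R}}$ respectively. Then $$\tilde u=S(u^{-1}).$$
   Context: A quasi-bialgebra $(H,\Delta,\epsilon,\Phi)$ over a field $k$ is a unital associative $k$-algebra $H$ with algebra homomorphisms $\epsilon:H\to k$, $\Delta:H\to H\otimes H$ and an invertible $\Phi\in H\otimes H\otimes H$ such that (with $1$ also denoting the identity map) $(1\otimes\Delta)\Delta(a)=\Phi^{-1}(\Delta\otimes 1)\Delta(a)\Phi$ for all $a\in H$; $(\Delta\otimes 1\otimes 1)\Phi\cdot(1\otimes 1\otimes\Delta)\Phi=(\Phi\otimes 1)\cdot(1\otimes\Delta\otimes 1)\Phi\cdot(1\otimes\Phi)$; $(\epsilon\otimes 1)\Delta=1=(1\otimes\epsilon)\Delta$; $(1\otimes\epsilon\otimes 1)\Phi=1$. Write $\Phi=\sum_\nu X_\nu\otimes Y_\nu\otimes Z_\nu$, $\Phi^{-1}=\sum_\nu\bar X_\nu\otimes\bar Y_\nu\otimes\bar Z_\nu$, $\Delta(a)=\sum a_{(1)}\otimes a_{(2)}$. A quasi-Hopf algebra $(H,\Delta,\epsilon,\Phi,S,\alpha,\beta)$ is a quasi-bialgebra with an algebra anti-homomorphism $S:H\to H$ (assumed bijective) and $\alpha,\beta\in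 H$ such that $\sum S(X_\nu)\alpha Y_\nu\beta S(Z_\nu)=1=\sum\bar X_\nu\beta S(\bar Y_\nu)\alpha\bar Z_\nu$ and $\sum S(a_{(1)})\alpha a_{(2)}=\epsilon(a)\alpha$, $\sum a_{(1)}\beta S(a_{(2)})=\epsilon(a)\beta$ for all $a\in H$. It is quasi-triangular if there is an invertible $\mathcal{R}=\sum e_i\otimes e^i\in H\otimes H$ (the $R$-matrix) with $\Delta^T(a)\mathcal{R}=\mathcal{R}\Delta(a)$ for all $a$, $(\Delta\otimes 1)\mathcal{R}=\Phi_{231}^{-1}\mathcal{R}_{13}\Phi_{132}\mathcal{R}_{23}\Phi_{123}^{-1}$, $(1\otimes\Delta)\mathcal{R}=\Phi_{312}\mathcal{R}_{13}\Phi_{213}^{-1}\mathcal{R}_{12}\Phi_{123}$. Here $\Delta^T=T\circ\Delta$ and $\mathcal{R}^T=T(\mathcal{R})$ with $T$ the flip, $\mathcal{R}_{12}=\sum e_i\otimes e^i\otimes 1$, $\mathcal{R}_{13}=\sum e_i\otimes 1\otimes e^i$, $\mathcal{R}_{23}=\sum 1\otimes e_i\otimes e^i$, and $\Phi_{123}=\Phi$, $\Phi_{132}=\sum X_\nu\otimes Z_\nu\otimes Y_\nu$, $\Phi_{213}=\sum Y_\nu\otimes X_\nu\otimes Z_\nu$, $\Phi_{231}=\sum Y_\nu\otimes Z_\nu\otimes X_\nu$, $\Phi_{312}=\sum Z_\nu\otimes X_\nu\otimes Y_\nu$. The element $\tilde{\mathcal{R}}=(\mathcal{R}^T)^{-1}$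 is also an $R$-matrix for $H$. For an $R$-matrix $Q=\sum q_i\otimes q^i$ with $Q^{-1}=\sum\bar q_i\otimes\bar q^i$, set $\alpha_Q=\sum S(\bar q_i)\alpha\bar q^i$, $\beta_Q=\sum q_i\beta S(q^i)$. The $u$-operator associated with $Q$ is the unique invertible $u_Q\in H$ with $S^2(a)=u_Q a u_Q^{-1}$ for all $a\in H$, $u_Q S^{-1}(\alpha)=\alpha_Q$, $\beta_Q u_Q=S^{-1}(\beta)$; explicitly $u_Q=\sum S(Y_\nu\beta S(Z_\nu))\alpha_Q X_\nu$. Then $u=u_{\mathcal{R}}$ (the Drinfeld–Reshetikhin operator) and $\tilde u=u_{\tilde{\mathcal{R}}}$ (the Altschuler–Coste operator). *)

theory Defs
  imports Complex_Main "HOL-Library.Poly_Mapping" "HOL-Algebra.Group"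
begin

unbundle no m_inv_syntax  \<comment> \<open>below, \<open>inv\<close> is the inverse function\<close>

section \<open>Free vector spaces\<close>

definition fscale :: "'k::field \<Rightarrow> ('w \<Rightarrow>\<^sub>0 'k) \<Rightarrow> ('w \<Rightarrow>\<^sub>0 'k)" where
  "fscale c p = Poly_Mapping.map ((*) c) p"

lemma lookup_fscale [simp]: "Poly_Mapping.lookup (fscale c p) w = c * Poly_Mapping.lookup p w"
  by (simp add: fscale_def Poly_Mapping.map.rep_eq when_def)

lemma fscale_single: "fscale c (Poly_Mapping.single w d) = Poly_Mapping.single w (c * d)"
  by (rule poly_mapping_eqI) (simp add: lookup_single when_def)

lemma vector_space_fscale: "vector_space fscale"
  by unfold_locales (auto intro!: poly_mapping_eqI simp: lookup_add algebra_simps)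

interpretation free: vector_space fscale
  by (rule vector_space_fscale)

definition lin_ext ::
    "('k::field \<Rightarrow> 'v::ab_group_add \<Rightarrow> 'v) \<Rightarrow> ('w \<Rightarrow> 'v) \<Rightarrow> ('w \<Rightarrow>\<^sub>0 'k) \<Rightarrow> 'v" where
  "lin_ext s f p = (\<Sum>w\<in>Poly_Mapping.keys p. s (Poly_Mapping.lookup p w) (f w))"

context vector_space
begin

lemma lin_ext_superset:
  assumes "finite A" "Poly_Mapping.keys p \<subseteq> A"
  shows "lin_ext scale f p = (\<Sum>w\<in>A. scale (Poly_Mapping.lookup p w) (f w))"
  unfolding lin_ext_def
  by (rule sum.mono_neutral_left) (use assms in \<open>auto simp: in_keys_iff\<close>)

lemma lin_ext_add: "lin_ext scale f (p + q) = lin_ext scale f p + lin_ext scale f q"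
proof -
  let ?A = "Poly_Mapping.keys p \<union> Poly_Mapping.keys q"
  have "lin_ext scale f r = (\<Sum>w\<in>?A. scale (Poly_Mapping.lookup r w) (f w))"
    if "r \<in> {p, q, p + q}" for r
    by (rule lin_ext_superset) (use that Poly_Mapping.keys_add[of p q] in auto)
  then show ?thesis
    by (simp add: lookup_add scale_left_distrib sum.distrib)
qed

lemma lin_ext_scale: "lin_ext scale f (fscale c p) = scale c (lin_ext scale f p)"
proof -
  have "lin_ext scale f (fscale c p) =
      (\<Sum>w\<in>Poly_Mapping.keys p. scale (Poly_Mapping.lookup (fscale c p) w) (f w))"
    by (rule lin_ext_superset) (auto simp: in_keys_iff)
  then show ?thesis
    by (simp add: lin_ext_def scale_sum_right)
qed

lemma module_hom_lin_ext: "module_hom fscale scale (lin_ext scale f)"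
  by unfold_locales (auto simp: lin_ext_add lin_ext_scale)

lemma lin_ext_single [simp]: "lin_ext scale f (Poly_Mapping.single w c) = scale c (f w)"
  by (cases "c = 0") (auto simp: lin_ext_def)

end

section \<open>Algebras over a field and their tensor powers\<close>

locale k_algebra = vector_space scale
  for scale :: "'k::field \<Rightarrow> 'h::ring_1 \<Rightarrow> 'h" +
  assumes scale_mult_left: "scale c a * b = scale c (a * b)"
    and scale_mult_right: "a * scale c b = scale c (a * b)"

text \<open>
  The tensor algebra of \<open>H\<close>: a word \<open>[x\<^sub>1, \<dots>, x\<^sub>n]\<close> over \<open>H\<close> stands for
  \<open>x\<^sub>1 \<otimes> \<dots> \<otimes> x\<^sub>n\<close>, and tensors are cosets in the free vector space on all words modulo
  the multilinearity relations. These relations are homogeneous in the length of words, so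
  the \<open>n\<close>-th tensor power is the image of the words of length \<open>n\<close>.
\<close>

type_synonym ('h, 'k) tensor = "('h list \<Rightarrow>\<^sub>0 'k) set"

context k_algebra
begin

definition multilinear_relations :: "('h list \<Rightarrow>\<^sub>0 'k) set" where
  "multilinear_relations =
     {Poly_Mapping.single (xs @ [a + b] @ ys) 1
        - Poly_Mapping.single (xs @ [a] @ ys) 1
        - Poly_Mapping.single (xs @ [b] @ ys) 1 | xs a b ys. True}
   \<union> {Poly_Mapping.single (xs @ [scale c a] @ ys) 1
        - fscale c (Poly_Mapping.single (xs @ [a] @ ys) 1) | xs c a ys. True}"

definition null_sums :: "('h list \<Rightarrow>\<^sub>0 'k) set" where
  "null_sums = module.span fscale multilinear_relations"

definition tclass :: "('h list \<Rightarrow>\<^sub>0 'k) \<Rightarrow> ('h, 'k) tensor" where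
  "tclass p = {q. q - p \<in> null_sums}"

definition rep :: "('h, 'k) tensor \<Rightarrow> ('h list \<Rightarrow>\<^sub>0 'k)" where
  "rep t = (SOME p. p \<in> t)"

definition tensor_power :: "nat \<Rightarrow> ('h, 'k) tensor set" where
  "tensor_power n = tclass ` {p. \<forall>w\<in>Poly_Mapping.keys p. length w = n}"

definition pure :: "'h list \<Rightarrow> ('h, 'k) tensor" where
  "pure w = tclass (Poly_Mapping.single w 1)"

definition tzero :: "('h, 'k) tensor" where
  "tzero = tclass 0"

definition tadd :: "('h, 'k) tensor \<Rightarrow> ('h, 'k) tensor \<Rightarrow> ('h, 'k) tensor"  (infixl \<open>\<boxplus>\<close> 65) where
  "s \<boxplus> t = tclass (rep s + rep t)"

definition tscale :: "'k \<Rightarrow> ('h, 'k) tensor \<Rightarrow> ('h, 'k) tensor" where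
  "tscale c t = tclass (fscale c (rep t))"

text \<open>
  Linear maps out of tensor powers, given on words. They are independent of the chosen
  representative whenever the map on words is multilinear (lemmas \<open>lift_tclass\<close> and
  \<open>tlift_tclass\<close> below). Since a representative may contain words of other lengths, maps out of
  one tensor power are extended by zero to all other words.
\<close>

definition lift :: "('h list \<Rightarrow> 'h) \<Rightarrow> ('h, 'k) tensor \<Rightarrow> 'h" where
  "lift f t = lin_ext scale f (rep t)"

definition tlift :: "('h list \<Rightarrow> ('h, 'k) tensor) \<Rightarrow> ('h, 'k) tensor \<Rightarrow> ('h, 'k) tensor" where
  "tlift f t = tclass (lin_ext fscale (\<lambda>w. rep (f w)) (rep t))"

definition lift2 :: "('h \<Rightarrow> 'h \<Rightarrow> 'h) \<Rightarrow> ('h, 'k) tensor \<Rightarrow> 'h" where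
  "lift2 f = lift (\<lambda>w. case w of [x, y] \<Rightarrow> f x y | _ \<Rightarrow> 0)"

definition lift3 :: "('h \<Rightarrow> 'h \<Rightarrow> 'h \<Rightarrow> 'h) \<Rightarrow> ('h, 'k) tensor \<Rightarrow> 'h" where
  "lift3 f = lift (\<lambda>w. case w of [x, y, z] \<Rightarrow> f x y z | _ \<Rightarrow> 0)"

definition tlift2 ::
    "('h \<Rightarrow> 'h \<Rightarrow> ('h, 'k) tensor) \<Rightarrow> ('h, 'k) tensor \<Rightarrow> ('h, 'k) tensor" where
  "tlift2 f = tlift (\<lambda>w. case w of [x, y] \<Rightarrow> f x y | _ \<Rightarrow> tzero)"

definition tlift3 ::
    "('h \<Rightarrow> 'h \<Rightarrow> 'h \<Rightarrow> ('h, 'k) tensor) \<Rightarrow> ('h, 'k) tensor \<Rightarrow> ('h, 'k) tensor" where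
  "tlift3 f = tlift (\<lambda>w. case w of [x, y, z] \<Rightarrow> f x y z | _ \<Rightarrow> tzero)"

text \<open>
  \<open>s \<boxtimes> t\<close> is the tensor product of tensors, \<open>s \<bullet> t\<close> the componentwise product in a fixed
  tensor power.
\<close>

definition tprod :: "('h, 'k) tensor \<Rightarrow> ('h, 'k) tensor \<Rightarrow> ('h, 'k) tensor"  (infixr \<open>\<boxtimes>\<close> 75) where
  "s \<boxtimes> t = tlift (\<lambda>v. tlift (\<lambda>w. pure (v @ w)) t) s"

definition tmult :: "('h, 'k) tensor \<Rightarrow> ('h, 'k) tensor \<Rightarrow> ('h, 'k) tensor"  (infixl \<open>\<bullet>\<close> 70) where
  "s \<bullet> t =
     tlift (\<lambda>v. tlift (\<lambda>w. if length v = length w then pure (map2 (*) v w) else tzero) t) s"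

definition tensor_alg :: "nat \<Rightarrow> ('h, 'k) tensor monoid" where
  "tensor_alg n =
     \<lparr>carrier = tensor_power n, mult = (\<bullet>), one = pure (replicate n 1)\<rparr>"

definition flip :: "('h, 'k) tensor \<Rightarrow> ('h, 'k) tensor" where
  "flip = tlift2 (\<lambda>x y. pure [y, x])"

subsection \<open>Independence of representatives\<close>

lemma tclass_eq_iff: "tclass p = tclass q \<longleftrightarrow> p - q \<in> null_sums"
proof
  assume "tclass p = tclass q"
  moreover have "p \<in> tclass p"
    using free.span_zero by (simp add: tclass_def null_sums_def)
  ultimately have "p \<in> tclass q"
    by simp
  then show "p - q \<in> null_sums"
    by (simp add: tclass_def)
next
  assume pq: "p - q \<in> null_sums"
  have "r - p \<in> null_sums \<longleftrightarrow> r - q \<in> null_sums" for r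
    using free.span_add[of "r - p" multilinear_relations "p - q"]
      free.span_diff[of "r - q" multilinear_relations "p - q"] pq
    by (auto simp: null_sums_def)
  then show "tclass p = tclass q"
    by (simp add: tclass_def)
qed

lemma tclass_rep_tclass [simp]: "tclass (rep (tclass p)) = tclass p"
proof -
  have "p \<in> tclass p"
    using free.span_zero by (simp add: tclass_def null_sums_def)
  then have "rep (tclass p) \<in> tclass p"
    unfolding rep_def by (rule someI)
  then show ?thesis
    by (simp add: tclass_eq_iff) (simp add: tclass_def)
qed

definition multilinear :: "('k \<Rightarrow> 'v::ab_group_add \<Rightarrow> 'v) \<Rightarrow> ('h list \<Rightarrow> 'v) \<Rightarrow> bool" where
  "multilinear s f \<longleftrightarrow>
     (\<forall>xs a b ys. f (xs @ [a + b] @ ys) = f (xs @ [a] @ ys) + f (xs @ [b] @ ys)) \<and>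
     (\<forall>xs c a ys. f (xs @ [scale c a] @ ys) = s c (f (xs @ [a] @ ys)))"

lemma lin_ext_null_sums:
  assumes "vector_space s" and "multilinear s f" and "p \<in> null_sums"
  shows "lin_ext s f p = 0"
proof -
  interpret V: vector_space s by fact
  interpret L: module_hom fscale s "lin_ext s f"
    by (rule V.module_hom_lin_ext)
  have "lin_ext s f r = 0" if "r \<in> multilinear_relations" for r
    using that assms(2)
    by (auto simp: multilinear_relations_def multilinear_def L.diff L.scale)
  then show ?thesis
    using assms(3) L.eq_0_on_span[of multilinear_relations p] by (auto simp: null_sums_def)
qed

lemma lin_ext_rep:
  assumes "vector_space s" and "multilinear s f"
  shows "lin_ext s f (rep (tclass p)) = lin_ext s f p"
proof -
  interpret V: vector_space s by fact
  interpret L: module_hom fscale s "lin_ext s f"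
    by (rule V.module_hom_lin_ext)
  have "rep (tclass p) - p \<in> null_sums"
    using tclass_rep_tclass[of p] by (simp only: tclass_eq_iff)
  then show ?thesis
    using lin_ext_null_sums[OF assms, of "rep (tclass p) - p"] by (simp add: L.diff)
qed

lemma lift_tclass: "multilinear scale f \<Longrightarrow> lift f (tclass p) = lin_ext scale f p"
  unfolding lift_def by (rule lin_ext_rep) unfold_locales

lemma lift_pure: "multilinear scale f \<Longrightarrow> lift f (pure w) = f w"
  by (simp add: pure_def lift_tclass)

lemma lift2_pure:
  assumes "\<And>x x' y. f (x + x') y = f x y + f x' y" "\<And>x y y'. f x (y + y') = f x y + f x y'"
    and "\<And>c x y. f (scale c x) y = scale c (f x y)" "\<And>c x y. f x (scale c y) = scale c (f x y)"
  shows "lift2 f (pure [x, y]) = f x y"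
proof -
  have "multilinear scale (\<lambda>w. case w of [x, y] \<Rightarrow> f x y | _ \<Rightarrow> 0)"
    unfolding multilinear_def
    by (auto simp: assms Cons_eq_append_conv append_eq_Cons_conv split: list.splits)
  then show ?thesis
    by (simp add: lift2_def lift_pure)
qed

lemma tlift_tclass:
  assumes add: "\<And>xs a b ys. f (xs @ [a + b] @ ys) = f (xs @ [a] @ ys) \<boxplus> f (xs @ [b] @ ys)"
    and scale: "\<And>xs c a ys. f (xs @ [scale c a] @ ys) = tscale c (f (xs @ [a] @ ys))"
  shows "tlift f (tclass p) = tclass (lin_ext fscale (\<lambda>w. rep (f w)) p)"
proof -
  let ?g = "\<lambda>w. rep (f w)"
  interpret L: module_hom fscale fscale "lin_ext fscale ?g"
    by (rule free.module_hom_lin_ext)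
  have rep: "rep (tclass q) - q \<in> null_sums" for q
    using tclass_rep_tclass[of q] by (simp only: tclass_eq_iff)
  have "lin_ext fscale ?g r \<in> null_sums" if "r \<in> multilinear_relations" for r
    using that
  proof (unfold multilinear_relations_def, elim UnE CollectE exE conjE)
    fix xs a b ys
    let ?A = "rep (f (xs @ [a] @ ys))" and ?B = "rep (f (xs @ [b] @ ys))"
    assume r: "r = Poly_Mapping.single (xs @ [a + b] @ ys) 1 -
        Poly_Mapping.single (xs @ [a] @ ys) 1 - Poly_Mapping.single (xs @ [b] @ ys) 1"
    have "lin_ext fscale ?g r = rep (f (xs @ [a + b] @ ys)) - ?A - ?B"
      unfolding r L.diff free.lin_ext_single by (simp only: free.scale_one)
    also have "\<dots> = rep (tclass (?A + ?B)) - (?A + ?B)"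
      unfolding add tadd_def by (rule diff_diff_eq)
    finally show ?thesis
      using rep by (simp only:)
  next
    fix xs c a ys
    let ?A = "rep (f (xs @ [a] @ ys))"
    assume r: "r = Poly_Mapping.single (xs @ [scale c a] @ ys) 1 -
        fscale c (Poly_Mapping.single (xs @ [a] @ ys) 1)"
    have "lin_ext fscale ?g r = rep (f (xs @ [scale c a] @ ys)) - fscale c ?A"
      unfolding r L.diff L.scale free.lin_ext_single by (simp only: free.scale_one)
    also have "\<dots> = rep (tclass (fscale c ?A)) - fscale c ?A"
      unfolding scale tscale_def by (rule refl)
    finally show ?thesis
      using rep by (simp only:)
  qed
  then have "lin_ext fscale ?g ` multilinear_relations \<subseteq> null_sums"
    by blast
  then have "free.span (lin_ext fscale ?g ` multilinear_relations) \<subseteq> null_sums"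
    unfolding null_sums_def by (rule free.span_minimal) (rule free.subspace_span)
  then have null: "lin_ext fscale ?g r \<in> null_sums" if "r \<in> null_sums" for r
    using that unfolding null_sums_def L.span_image by blast
  have "lin_ext fscale ?g (rep (tclass p)) - lin_ext fscale ?g p \<in> null_sums"
    using null[OF rep[of p]] by (simp only: L.diff)
  then show ?thesis
    by (simp only: tlift_def tclass_eq_iff)
qed

lemma tlift_pure:
  assumes "\<And>xs a b ys. f (xs @ [a + b] @ ys) = f (xs @ [a] @ ys) \<boxplus> f (xs @ [b] @ ys)"
    and "\<And>xs c a ys. f (xs @ [scale c a] @ ys) = tscale c (f (xs @ [a] @ ys))"
    and "f w \<in> range tclass"
  shows "tlift f (pure w) = f w"
proof -
  obtain q where q: "f w = tclass q"
    using assms(3) by blast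
  have "tlift f (pure w) = tclass (lin_ext fscale (\<lambda>w. rep (f w)) (Poly_Mapping.single w 1))"
    unfolding pure_def by (rule tlift_tclass) (fact assms(1), fact assms(2))
  also have "\<dots> = tclass (rep (f w))"
    by (simp only: free.lin_ext_single free.scale_one)
  finally show ?thesis
    by (simp only: q tclass_rep_tclass)
qed

end

section \<open>Quasi-bialgebras\<close>

locale quasi_bialgebra = k_algebra scale
  for scale :: "'k::field \<Rightarrow> 'h::ring_1 \<Rightarrow> 'h" +
  fixes \<Delta> :: "'h \<Rightarrow> ('h, 'k) tensor"
    and \<epsilon> :: "'h \<Rightarrow> 'k"
    and \<Phi> :: "('h, 'k) tensor"
  assumes Delta_closed: "\<Delta> a \<in> tensor_power 2"
    and Delta_add: "\<Delta> (a + b) = \<Delta> a \<boxplus> \<Delta> b"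
    and Delta_scale: "\<Delta> (scale c a) = tscale c (\<Delta> a)"
    and Delta_mult: "\<Delta> (a * b) = \<Delta> a \<bullet> \<Delta> b"
    and Delta_one: "\<Delta> 1 = pure [1, 1]"
    and eps_add: "\<epsilon> (a + b) = \<epsilon> a + \<epsilon> b"
    and eps_scale: "\<epsilon> (scale c a) = c * \<epsilon> a"
    and eps_mult: "\<epsilon> (a * b) = \<epsilon> a * \<epsilon> b"
    and eps_one: "\<epsilon> 1 = 1"
    and Phi_invertible: "\<Phi> \<in> Units (tensor_alg 3)"
    and quasi_coassoc:
      "tlift2 (\<lambda>x y. pure [x] \<boxtimes> \<Delta> y) (\<Delta> a) =
         m_inv (tensor_alg 3) \<Phi> \<bullet> tlift2 (\<lambda>x y. \<Delta> x \<boxtimes> pure [y]) (\<Delta> a) \<bullet> \<Phi>"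
    and pentagon:
      "tlift3 (\<lambda>x y z. \<Delta> x \<boxtimes> pure [y, z]) \<Phi> \<bullet> tlift3 (\<lambda>x y z. pure [x, y] \<boxtimes> \<Delta> z) \<Phi> =
         (\<Phi> \<boxtimes> pure [1]) \<bullet> tlift3 (\<lambda>x y z. pure [x] \<boxtimes> \<Delta> y \<boxtimes> pure [z]) \<Phi> \<bullet> (pure [1] \<boxtimes> \<Phi>)"
    and counit_left: "lift2 (\<lambda>x y. scale (\<epsilon> x) y) (\<Delta> a) = a"
    and counit_right: "lift2 (\<lambda>x y. scale (\<epsilon> y) x) (\<Delta> a) = a"
    and counit_Phi: "tlift3 (\<lambda>x y z. tscale (\<epsilon> y) (pure [x, z])) \<Phi> = pure [1, 1]"
begin

abbreviation Phi_inv :: "('h, 'k) tensor" where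
  "Phi_inv \<equiv> m_inv (tensor_alg 3) \<Phi>"

text \<open>
  \<open>leg\<^sub>1\<^sub>3\<^sub>2 t\<close> is \<open>t\<^sub>1\<^sub>3\<^sub>2\<close>, etc.; as these maps permute tensor factors, they are
  algebra automorphisms, and \<open>\<Phi>\<^sub>2\<^sub>3\<^sub>1\<^sup>-\<^sup>1\<close> is the inverse of \<open>\<Phi>\<^sub>2\<^sub>3\<^sub>1\<close>.
\<close>

definition leg132 :: "('h, 'k) tensor \<Rightarrow> ('h, 'k) tensor" where
  "leg132 = tlift3 (\<lambda>x y z. pure [x, z, y])"

definition leg213 :: "('h, 'k) tensor \<Rightarrow> ('h, 'k) tensor" where
  "leg213 = tlift3 (\<lambda>x y z. pure [y, x, z])"

definition leg231 :: "('h, 'k) tensor \<Rightarrow> ('h, 'k) tensor" where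
  "leg231 = tlift3 (\<lambda>x y z. pure [y, z, x])"

definition leg312 :: "('h, 'k) tensor \<Rightarrow> ('h, 'k) tensor" where
  "leg312 = tlift3 (\<lambda>x y z. pure [z, x, y])"

definition leg12 :: "('h, 'k) tensor \<Rightarrow> ('h, 'k) tensor" where
  "leg12 = tlift2 (\<lambda>x y. pure [x, y, 1])"

definition leg13 :: "('h, 'k) tensor \<Rightarrow> ('h, 'k) tensor" where
  "leg13 = tlift2 (\<lambda>x y. pure [x, 1, y])"

definition leg23 :: "('h, 'k) tensor \<Rightarrow> ('h, 'k) tensor" where
  "leg23 = tlift2 (\<lambda>x y. pure [1, x, y])"

definition R_matrix :: "('h, 'k) tensor \<Rightarrow> bool" where
  "R_matrix Q \<longleftrightarrow>
     Q \<in> Units (tensor_alg 2) \<and>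
     (\<forall>a. flip (\<Delta> a) \<bullet> Q = Q \<bullet> \<Delta> a) \<and>
     tlift2 (\<lambda>x y. \<Delta> x \<boxtimes> pure [y]) Q =
       m_inv (tensor_alg 3) (leg231 \<Phi>) \<bullet> leg13 Q \<bullet> leg132 \<Phi> \<bullet> leg23 Q \<bullet> Phi_inv \<and>
     tlift2 (\<lambda>x y. pure [x] \<boxtimes> \<Delta> y) Q =
       leg312 \<Phi> \<bullet> leg13 Q \<bullet> m_inv (tensor_alg 3) (leg213 \<Phi>) \<bullet> leg12 Q \<bullet> \<Phi>"

end

section \<open>Quasi-Hopf algebras with bijective antipode\<close>

locale quasi_Hopf_algebra = quasi_bialgebra scale \<Delta> \<epsilon> \<Phi>
  for scale :: "'k::field \<Rightarrow> 'h::ring_1 \<Rightarrow> 'h" and \<Delta> \<epsilon> \<Phi> +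
  fixes S :: "'h \<Rightarrow> 'h"
    and \<alpha> \<beta> :: 'h
  assumes S_add: "S (a + b) = S a + S b"
    and S_scale: "S (scale c a) = scale c (S a)"
    and S_mult: "S (a * b) = S b * S a"
    and S_one: "S 1 = 1"
    and S_bij: "bij S"
    and S_alpha_beta: "lift3 (\<lambda>x y z. S x * \<alpha> * y * \<beta> * S z) \<Phi> = 1"
    and beta_S_alpha: "lift3 (\<lambda>x y z. x * \<beta> * S y * \<alpha> * z) (m_inv (tensor_alg 3) \<Phi>) = 1"
    and antipode_alpha: "lift2 (\<lambda>x y. S x * \<alpha> * y) (\<Delta> a) = scale (\<epsilon> a) \<alpha>"
    and antipode_beta: "lift2 (\<lambda>x y. x * \<beta> * S y) (\<Delta> a) = scale (\<epsilon> a) \<beta>"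

definition mult_monoid :: "'h::ring_1 monoid" where
  "mult_monoid = \<lparr>carrier = UNIV, mult = (*), one = 1\<rparr>"

context quasi_Hopf_algebra
begin

definition alpha_op :: "('h, 'k) tensor \<Rightarrow> 'h" where
  "alpha_op Q = lift2 (\<lambda>x y. S x * \<alpha> * y) (m_inv (tensor_alg 2) Q)"

definition beta_op :: "('h, 'k) tensor \<Rightarrow> 'h" where
  "beta_op Q = lift2 (\<lambda>x y. x * \<beta> * S y) Q"

definition is_u_operator :: "('h, 'k) tensor \<Rightarrow> 'h \<Rightarrow> bool" where
  "is_u_operator Q u \<longleftrightarrow>
     u \<in> Units mult_monoid \<and>
     (\<forall>a. S (S a) = u * a * m_inv mult_monoid u) \<and>
     u * inv S \<alpha> = alpha_op Q \<and>
     beta_op Q * u = inv S \<beta>"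

definition tilde :: "('h, 'k) tensor \<Rightarrow> ('h, 'k) tensor" where
  "tilde Q = m_inv (tensor_alg 2) (flip Q)"

end

locale quasi_triangular_quasi_Hopf_algebra = quasi_Hopf_algebra scale \<Delta> \<epsilon> \<Phi> S \<alpha> \<beta>
  for scale :: "'k::field \<Rightarrow> 'h::ring_1 \<Rightarrow> 'h" and \<Delta> \<epsilon> \<Phi> S \<alpha> \<beta> +
  fixes \<R> :: "('h, 'k) tensor"
  assumes R_matrix_R: "R_matrix \<R>"

end

theory Submission
  imports Defs
begin

text \<open>
  A \<open>u\<close>-operator \<open>u\<close> for \<open>Q\<close> is determined by two of its properties: it implements \<open>S\<^sup>2\<close> by
  conjugation, and \<open>\<beta>\<^sub>Q u = S\<^sup>-\<^sup>1(\<beta>)\<close>. Indeed two such elements differ by a central factor \<open>c\<close>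
  with \<open>S\<^sup>-\<^sup>1(\<beta>) c = S\<^sup>-\<^sup>1(\<beta>)\<close>, so \<open>S(c)\<close> is central and fixes \<open>\<beta>\<close>; multiplying
  \<open>\<Sum> S(X\<^sub>\<nu>) \<alpha> Y\<^sub>\<nu> \<beta> S(Z\<^sub>\<nu>) = 1\<close> by \<open>S(c)\<close> gives \<open>S(c) = 1\<close>
  (lemmas \<open>central_eq_one\<close> and \<open>u_operator_eqI\<close>).

  It remains to see that \<open>S(u\<^sup>-\<^sup>1)\<close> has these two properties for
  \<open>Q = (\<R>\<^sup>T)\<^sup>-\<^sup>1 = \<Sum> f\<^sup>i \<otimes> f\<^sub>i\<close>, where \<open>\<R>\<^sup>-\<^sup>1 = \<Sum> f\<^sub>i \<otimes> f\<^sup>i\<close> and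
  \<open>\<R> = \<Sum> e\<^sub>j \<otimes> e\<^sup>j\<close>. The first one is \<open>S\<close> applied to the corresponding property of \<open>u\<close>. For
  the second one (lemma \<open>beta_op_flip\<close>), move \<open>u\<close> past \<open>S\<^sup>-\<^sup>1(f\<^sup>i)\<close> and insert
  \<open>S\<^sup>-\<^sup>1(\<beta>) = \<beta>\<^sub>\<R> u\<close>:
  \<open>S\<^sup>-\<^sup>1(\<Sum> f\<^sup>i \<beta> S(f\<^sub>i) S(u\<^sup>-\<^sup>1)) = \<Sum> u\<^sup>-\<^sup>1 f\<^sub>i S\<^sup>-\<^sup>1(\<beta>) S\<^sup>-\<^sup>1(f\<^sup>i)
     = \<Sum> u\<^sup>-\<^sup>1 f\<^sub>i e\<^sub>j \<beta> S(f\<^sup>i e\<^sup>j) u = u\<^sup>-\<^sup>1 \<beta> u = S\<^sup>-\<^sup>2(\<beta>)\<close>,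
  because the double sum only involves \<open>\<R>\<^sup>-\<^sup>1 \<R> = 1 \<otimes> 1\<close>.

  What this needs from the tensor algebra is that the tensor powers are monoids and that the flip
  is multiplicative, so that \<open>(\<R>\<^sup>T)\<^sup>-\<^sup>1 = (\<R>\<^sup>-\<^sup>1)\<^sup>T\<close>. Both facts come from the free vector space on
  words: the componentwise product and the flip are induced by linear maps there, for which
  associativity and multiplicativity hold exactly, not only modulo the multilinearity relations.
\<close>

section \<open>Linear maps between spaces of words and tensors\<close>

context k_algebra
begin

lemma rep_tclass_diff: "rep (tclass p) - p \<in> null_sums"
  using tclass_rep_tclass[of p] by (simp only: tclass_eq_iff)

lemma subspace_null_sums: "free.subspace null_sums"
  unfolding null_sums_def by (rule free.subspace_span)

lemma tadd_tclass: "tclass p \<boxplus> tclass q = tclass (p + q)"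
proof -
  have "(rep (tclass p) - p) + (rep (tclass q) - q) \<in> null_sums"
    by (intro free.subspace_add subspace_null_sums rep_tclass_diff)
  then show ?thesis
    by (simp add: tadd_def tclass_eq_iff algebra_simps)
qed

lemma tscale_tclass: "tscale c (tclass p) = tclass (fscale c p)"
proof -
  have "fscale c (rep (tclass p) - p) \<in> null_sums"
    by (intro free.subspace_scale subspace_null_sums rep_tclass_diff)
  then show ?thesis
    by (simp add: tscale_def tclass_eq_iff free.scale_right_diff_distrib)
qed

lemma lin_ext_in_subspace:
  assumes "free.subspace V" "\<And>w. w \<in> Poly_Mapping.keys p \<Longrightarrow> f w \<in> V"
  shows "lin_ext fscale f p \<in> V"
  unfolding lin_ext_def
  by (intro free.subspace_sum free.subspace_scale assms)

lemma lin_ext_cong: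
  "(\<And>w. w \<in> Poly_Mapping.keys p \<Longrightarrow> f w = g w) \<Longrightarrow> lin_ext s f p = lin_ext s g p"
  by (simp add: lin_ext_def)

lemma lin_ext_zero: "lin_ext fscale (\<lambda>w. 0) p = 0"
  by (simp add: lin_ext_def)

lemma lin_ext_fun_diff:
  "lin_ext fscale (\<lambda>w. f w - g w) p = lin_ext fscale f p - lin_ext fscale g p"
  by (simp add: lin_ext_def free.scale_right_diff_distrib sum_subtractf)

lemma lin_ext_fun_scale:
  "lin_ext fscale (\<lambda>w. fscale c (f w)) p = fscale c (lin_ext fscale f p)"
  by (simp add: lin_ext_def free.scale_left_commute free.scale_sum_right del: free.scale_scale)

lemma lin_ext_lin_ext:
  assumes "vector_space s"
  shows "lin_ext s f (lin_ext fscale g p) = lin_ext s (\<lambda>w. lin_ext s f (g w)) p"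
proof -
  interpret V: vector_space s by fact
  interpret L: module_hom fscale s "lin_ext s f"
    by (rule V.module_hom_lin_ext)
  show ?thesis
    by (simp add: lin_ext_def[of fscale] lin_ext_def[of s _ p] L.sum L.scale)
qed

lemma lin_ext_id: "lin_ext fscale (\<lambda>w. Poly_Mapping.single w 1) p = p"
  by (rule poly_mapping_eqI)
    (auto simp: lin_ext_def lookup_sum lookup_single when_def in_keys_iff if_distrib
      cong: if_cong)

text \<open>
  A map on words with values in the free vector space induces a linear map on tensors if it is
  multilinear up to \<open>null_sums\<close>. Asking for no more than this admits values such as
  \<open>Poly_Mapping.single w 1\<close>, which depend on the letters of \<open>w\<close> in no linear way.
\<close>

definition null_multilinear :: "('h list \<Rightarrow> ('h list \<Rightarrow>\<^sub>0 'k)) \<Rightarrow> bool" where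
  "null_multilinear g \<longleftrightarrow>
     (\<forall>xs a b ys. g (xs @ [a + b] @ ys) - g (xs @ [a] @ ys) - g (xs @ [b] @ ys) \<in> null_sums) \<and>
     (\<forall>xs c a ys. g (xs @ [scale c a] @ ys) - fscale c (g (xs @ [a] @ ys)) \<in> null_sums)"

lemma tlift_null_multilinear:
  assumes "null_multilinear g"
  shows "tlift (\<lambda>w. tclass (g w)) (tclass p) = tclass (lin_ext fscale g p)"
proof -
  have "tlift (\<lambda>w. tclass (g w)) (tclass p) =
      tclass (lin_ext fscale (\<lambda>w. rep (tclass (g w))) p)"
    by (rule tlift_tclass; unfold tadd_tclass tscale_tclass tclass_eq_iff)
      (use assms in \<open>simp_all add: null_multilinear_def diff_diff_eq\<close>)
  also have "\<dots> = tclass (lin_ext fscale g p)"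
    unfolding tclass_eq_iff lin_ext_fun_diff[symmetric]
    by (intro lin_ext_in_subspace subspace_null_sums rep_tclass_diff)
  finally show ?thesis .
qed

lemma single_add_null:
  "Poly_Mapping.single (xs @ [a + b] @ ys) 1 - Poly_Mapping.single (xs @ [a] @ ys) 1
     - Poly_Mapping.single (xs @ [b] @ ys) 1 \<in> null_sums"
  unfolding null_sums_def multilinear_relations_def
  by (rule free.span_base, rule UnI1, blast)

lemma single_scale_null:
  "Poly_Mapping.single (xs @ [scale c a] @ ys) 1
     - fscale c (Poly_Mapping.single (xs @ [a] @ ys) 1) \<in> null_sums"
  unfolding null_sums_def multilinear_relations_def
  by (rule free.span_base, rule UnI2, blast)

section \<open>Tensor powers as monoids\<close>

definition word_mult :: "'h list \<Rightarrow> 'h list \<Rightarrow> ('h list \<Rightarrow>\<^sub>0 'k)" where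
  "word_mult v w =
     (if length v = length w then Poly_Mapping.single (map2 (*) v w) 1 else 0)"

definition free_mult ::
    "('h list \<Rightarrow>\<^sub>0 'k) \<Rightarrow> ('h list \<Rightarrow>\<^sub>0 'k) \<Rightarrow> ('h list \<Rightarrow>\<^sub>0 'k)" where
  "free_mult p q = lin_ext fscale (\<lambda>v. lin_ext fscale (word_mult v) q) p"

text \<open>
  Cutting the other factor of a product at the position of \<open>a\<close> makes \<open>map2\<close> distribute over the
  three parts.
\<close>

lemma word_mult_split:
  assumes "length w = length (xs @ [a] @ ys)"
  obtains xs' c ys' where "w = xs' @ [c] @ ys'" "length xs' = length xs" "length ys' = length ys"
proof
  show "w = take (length xs) w @ [w ! length xs] @ drop (Suc (length xs)) w"
    using assms by (simp add: id_take_nth_drop[symmetric])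
qed (use assms in simp_all)

text \<open>
  Multiplying by a fixed word turns a multilinearity relation at one position into a
  multilinearity relation at the same position, or kills it when the lengths differ.
\<close>

lemma null_multilinear_word_mult_right: "null_multilinear (word_mult v)"
  unfolding null_multilinear_def
proof (intro conjI allI)
  fix xs ys :: "'h list" and a b :: 'h and c
  let ?G = "\<lambda>x. word_mult v (xs @ [x] @ ys)"
  show "?G (a + b) - ?G a - ?G b \<in> null_sums"
  proof (cases "length v = length (xs @ [a] @ ys)")
    case True
    then obtain xs' d ys' where "v = xs' @ [d] @ ys'" "length xs' = length xs" "length ys' = length ys"
      by (rule word_mult_split)
    then show ?thesis
      using single_add_null[of "map2 (*) xs' xs" "d * a" "d * b" "map2 (*) ys' ys"]
      by (simp add: word_mult_def distrib_left)
  qed (use free.subspace_0[OF subspace_null_sums] in \<open>simp add: word_mult_def\<close>)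
  show "?G (scale c a) - fscale c (?G a) \<in> null_sums"
  proof (cases "length v = length (xs @ [a] @ ys)")
    case True
    then obtain xs' d ys' where "v = xs' @ [d] @ ys'" "length xs' = length xs" "length ys' = length ys"
      by (rule word_mult_split)
    then show ?thesis
      using single_scale_null[of "map2 (*) xs' xs" c "d * a" "map2 (*) ys' ys"]
      by (simp add: word_mult_def scale_mult_right)
  qed (use free.subspace_0[OF subspace_null_sums] in \<open>simp add: word_mult_def\<close>)
qed

lemma null_multilinear_word_mult_left: "null_multilinear (\<lambda>v. word_mult v w)"
  unfolding null_multilinear_def
proof (intro conjI allI)
  fix xs ys :: "'h list" and a b :: 'h and c
  let ?G = "\<lambda>x. word_mult (xs @ [x] @ ys) w"
  show "?G (a + b) - ?G a - ?G b \<in> null_sums"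
  proof (cases "length w = length (xs @ [a] @ ys)")
    case True
    then obtain xs' d ys' where "w = xs' @ [d] @ ys'" "length xs' = length xs" "length ys' = length ys"
      by (rule word_mult_split)
    then show ?thesis
      using single_add_null[of "map2 (*) xs xs'" "a * d" "b * d" "map2 (*) ys ys'"]
      by (simp add: word_mult_def distrib_right)
  qed (use free.subspace_0[OF subspace_null_sums] in \<open>simp add: word_mult_def\<close>)
  show "?G (scale c a) - fscale c (?G a) \<in> null_sums"
  proof (cases "length w = length (xs @ [a] @ ys)")
    case True
    then obtain xs' d ys' where "w = xs' @ [d] @ ys'" "length xs' = length xs" "length ys' = length ys"
      by (rule word_mult_split)
    then show ?thesis
      using single_scale_null[of "map2 (*) xs xs'" c "a * d" "map2 (*) ys ys'"]
      by (simp add: word_mult_def scale_mult_left)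
  qed (use free.subspace_0[OF subspace_null_sums] in \<open>simp add: word_mult_def\<close>)
qed

lemma tmult_tclass: "tclass p \<bullet> tclass q = tclass (free_mult p q)"
proof -
  have inner: "tlift (\<lambda>w. if length v = length w then pure (map2 (*) v w) else tzero) (tclass q) =
      tclass (lin_ext fscale (word_mult v) q)" for v
    using tlift_null_multilinear[OF null_multilinear_word_mult_right, of v q]
    by (simp add: word_mult_def pure_def tzero_def if_distrib cong: if_cong)
  have "null_multilinear (\<lambda>v. lin_ext fscale (word_mult v) q)"
    using null_multilinear_word_mult_left
    unfolding null_multilinear_def lin_ext_fun_diff[symmetric] lin_ext_fun_scale[symmetric]
    by (intro conjI allI lin_ext_in_subspace subspace_null_sums) blast+
  from tlift_null_multilinear[OF this, of p] show ?thesis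
    unfolding tmult_def inner free_mult_def .
qed

text \<open>
  This turns every evaluation of a product into a double sum over the words of the factors;
  identities between products are then checked word by word.
\<close>

lemma lin_ext_free_mult:
  assumes "vector_space s"
  shows "lin_ext s f (free_mult p q) =
    lin_ext s (\<lambda>v. lin_ext s (\<lambda>w. if length v = length w then f (map2 (*) v w) else 0) q) p"
proof -
  interpret V: vector_space s by fact
  have "lin_ext s f (word_mult v w) = (if length v = length w then f (map2 (*) v w) else 0)" for v w
    by (simp add: word_mult_def lin_ext_def)
  then show ?thesis
    by (simp add: free_mult_def lin_ext_lin_ext[OF assms])
qed

lemma map2_mult_assoc:
  "map2 (*) (map2 (*) u v) w = map2 (*) u (map2 (*) v (w :: 'a :: semigroup_mult list))"
  by (auto simp: list_eq_iff_nth_eq mult.assoc)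

lemma free_mult_assoc: "free_mult (free_mult p q) r = free_mult p (free_mult q r)"
proof -
  have left: "free_mult (free_mult p q) r = lin_ext fscale (\<lambda>u. lin_ext fscale (\<lambda>v.
      lin_ext fscale (\<lambda>w. if length u = length v then word_mult (map2 (*) u v) w else 0) r) q) p"
    unfolding free_mult_def[of "free_mult p q"] lin_ext_free_mult[OF vector_space_fscale]
    by (intro lin_ext_cong) (simp add: lin_ext_zero)
  have right: "free_mult p (free_mult q r) = lin_ext fscale (\<lambda>u. lin_ext fscale (\<lambda>v.
      lin_ext fscale (\<lambda>w. if length v = length w then word_mult u (map2 (*) v w) else 0) r) q) p"
    unfolding free_mult_def[of p] lin_ext_free_mult[OF vector_space_fscale] ..
  show ?thesis
    unfolding left right
    by (intro lin_ext_cong) (auto simp: word_mult_def map2_mult_assoc)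
qed

lemma map2_mult_one_left: "length w = n \<Longrightarrow> map2 (*) (replicate n (1 :: 'a :: monoid_mult)) w = w"
  by (auto simp: list_eq_iff_nth_eq)

lemma map2_mult_one_right: "length w = n \<Longrightarrow> map2 (*) w (replicate n (1 :: 'a :: monoid_mult)) = w"
  by (auto simp: list_eq_iff_nth_eq)

lemma free_mult_one_left:
  assumes "\<forall>w\<in>Poly_Mapping.keys p. length w = n"
  shows "free_mult (Poly_Mapping.single (replicate n 1) 1) p = p"
proof -
  have "free_mult (Poly_Mapping.single (replicate n 1) 1) p =
      lin_ext fscale (\<lambda>w. Poly_Mapping.single w 1) p"
    unfolding free_mult_def free.lin_ext_single free.scale_one
    by (intro lin_ext_cong) (use assms in \<open>simp add: word_mult_def map2_mult_one_left\<close>)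
  then show ?thesis
    by (simp add: lin_ext_id)
qed

lemma free_mult_one_right:
  assumes "\<forall>w\<in>Poly_Mapping.keys p. length w = n"
  shows "free_mult p (Poly_Mapping.single (replicate n 1) 1) = p"
proof -
  have "free_mult p (Poly_Mapping.single (replicate n 1) 1) =
      lin_ext fscale (\<lambda>w. Poly_Mapping.single w 1) p"
    unfolding free_mult_def free.lin_ext_single free.scale_one
    by (intro lin_ext_cong) (use assms in \<open>simp add: word_mult_def map2_mult_one_right\<close>)
  then show ?thesis
    by (simp add: lin_ext_id)
qed

lemma subspace_homogeneous:
  "free.subspace {p :: 'h list \<Rightarrow>\<^sub>0 'k. \<forall>w\<in>Poly_Mapping.keys p. length w = n}"
proof (rule free.subspaceI)
  fix p q :: "'h list \<Rightarrow>\<^sub>0 'k"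
  assume "p \<in> {p. \<forall>w\<in>Poly_Mapping.keys p. length w = n}" "q \<in> {p. \<forall>w\<in>Poly_Mapping.keys p. length w = n}"
  then show "p + q \<in> {p. \<forall>w\<in>Poly_Mapping.keys p. length w = n}"
    using Poly_Mapping.keys_add[of p q] by auto
qed (auto simp: in_keys_iff)

lemma free_mult_homogeneous:
  assumes "\<forall>w\<in>Poly_Mapping.keys p. length w = n"
  shows "\<forall>w\<in>Poly_Mapping.keys (free_mult p q). length w = n"
proof -
  have "free_mult p q \<in> {p. \<forall>w\<in>Poly_Mapping.keys p. length w = n}"
    unfolding free_mult_def
    by (intro lin_ext_in_subspace subspace_homogeneous) (use assms in \<open>auto simp: word_mult_def\<close>)
  then show ?thesis by simp
qed

text \<open>
  The laws descend from the free vector space; for the unit laws a representative must be chosen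
  that is supported on words of length \<open>n\<close>, since a product with \<open>1 \<otimes> \<dots> \<otimes> 1\<close> annihilates the
  words of all other lengths.
\<close>

lemma monoid_tensor_alg: "monoid (tensor_alg n)"
proof (rule monoidI)
  let ?C = "{p :: 'h list \<Rightarrow>\<^sub>0 'k. \<forall>w\<in>Poly_Mapping.keys p. length w = n}"
  have carrier: "carrier (tensor_alg n) = tclass ` ?C" and mult: "mult (tensor_alg n) = (\<bullet>)"
    and one: "\<one>\<^bsub>tensor_alg n\<^esub> = tclass (Poly_Mapping.single (replicate n 1) 1)"
    by (simp_all add: tensor_alg_def tensor_power_def pure_def)
  show "\<one>\<^bsub>tensor_alg n\<^esub> \<in> carrier (tensor_alg n)"
    unfolding carrier one by (rule imageI) simp
  fix x assume "x \<in> carrier (tensor_alg n)"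
  then obtain p where p: "x = tclass p" "\<forall>w\<in>Poly_Mapping.keys p. length w = n"
    unfolding carrier by blast
  show "\<one>\<^bsub>tensor_alg n\<^esub> \<otimes>\<^bsub>tensor_alg n\<^esub> x = x"
    unfolding mult one p(1) tmult_tclass free_mult_one_left[OF p(2)] ..
  show "x \<otimes>\<^bsub>tensor_alg n\<^esub> \<one>\<^bsub>tensor_alg n\<^esub> = x"
    unfolding mult one p(1) tmult_tclass free_mult_one_right[OF p(2)] ..
  fix y assume "y \<in> carrier (tensor_alg n)"
  then obtain q where q: "y = tclass q"
    unfolding carrier by blast
  show "x \<otimes>\<^bsub>tensor_alg n\<^esub> y \<in> carrier (tensor_alg n)"
    unfolding carrier mult p(1) q tmult_tclass
    by (intro imageI CollectI free_mult_homogeneous p(2))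
  fix z assume "z \<in> carrier (tensor_alg n)"
  then obtain r where r: "z = tclass r"
    unfolding carrier by blast
  show "x \<otimes>\<^bsub>tensor_alg n\<^esub> y \<otimes>\<^bsub>tensor_alg n\<^esub> z = x \<otimes>\<^bsub>tensor_alg n\<^esub> (y \<otimes>\<^bsub>tensor_alg n\<^esub> z)"
    unfolding mult p(1) q r tmult_tclass free_mult_assoc ..
qed

section \<open>The flip\<close>

definition word_flip :: "'h list \<Rightarrow> ('h list \<Rightarrow>\<^sub>0 'k)" where
  "word_flip w = (if length w = 2 then Poly_Mapping.single (rev w) 1 else 0)"

lemma null_multilinear_word_flip: "null_multilinear word_flip"
  unfolding null_multilinear_def
proof (intro conjI allI)
  fix xs ys :: "'h list" and a b :: 'h and c
  let ?G = "\<lambda>x. word_flip (xs @ [x] @ ys)"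
  show "?G (a + b) - ?G a - ?G b \<in> null_sums"
    using single_add_null[of "rev ys" a b "rev xs"] free.subspace_0[OF subspace_null_sums]
    by (simp add: word_flip_def)
  show "?G (scale c a) - fscale c (?G a) \<in> null_sums"
    using single_scale_null[of "rev ys" c a "rev xs"] free.subspace_0[OF subspace_null_sums]
    by (simp add: word_flip_def)
qed

lemma flip_tclass: "flip (tclass p) = tclass (lin_ext fscale word_flip p)"
proof -
  have "(\<lambda>w. case w of [x, y] \<Rightarrow> pure [y, x] | _ \<Rightarrow> tzero) = (\<lambda>w. tclass (word_flip w))"
    by (auto simp: word_flip_def pure_def tzero_def fun_eq_iff split: list.splits)
  then show ?thesis
    by (simp add: flip_def tlift2_def tlift_null_multilinear null_multilinear_word_flip)
qed

lemma flip_closed: "t \<in> tensor_power n \<Longrightarrow> flip t \<in> tensor_power 2"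
proof -
  assume "t \<in> tensor_power n"
  then obtain p where p: "t = tclass p"
    by (auto simp: tensor_power_def)
  have "lin_ext fscale word_flip p \<in> {p. \<forall>w\<in>Poly_Mapping.keys p. length w = 2}"
    by (intro lin_ext_in_subspace subspace_homogeneous) (auto simp: word_flip_def split: list.splits)
  then show ?thesis
    by (auto simp: p flip_tclass tensor_power_def)
qed

lemma flip_tmult: "flip (tclass p \<bullet> tclass q) = flip (tclass p) \<bullet> flip (tclass q)"
proof -
  have "lin_ext fscale word_flip (free_mult p q) =
      lin_ext fscale (\<lambda>v. lin_ext fscale (\<lambda>w.
        lin_ext fscale (\<lambda>v'. lin_ext fscale (word_mult v') (word_flip w)) (word_flip v)) q) p"
    unfolding lin_ext_free_mult[OF vector_space_fscale]
    by (intro lin_ext_cong)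
      (simp add: word_flip_def word_mult_def zip_rev rev_map[symmetric]
        lin_ext_def[of _ _ "Poly_Mapping.single _ _"] lin_ext_def[of _ _ 0])
  also have "\<dots> = free_mult (lin_ext fscale word_flip p) (lin_ext fscale word_flip q)"
    unfolding free_mult_def lin_ext_lin_ext[OF vector_space_fscale]
    by (intro lin_ext_cong)
      (simp add: word_flip_def lin_ext_zero lin_ext_def[of _ _ 0])
  finally show ?thesis
    by (simp add: tmult_tclass flip_tclass)
qed

lemma flip_one: "flip (pure [1, 1]) = pure [1, 1]"
  by (simp add: pure_def flip_tclass word_flip_def)

lemma tensor_power_tclass: "t \<in> tensor_power n \<Longrightarrow> \<exists>p. t = tclass p"
  by (auto simp: tensor_power_def)

lemma inv_flip:
  assumes "Q \<in> Units (tensor_alg 2)"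
  shows "m_inv (tensor_alg 2) (flip Q) = flip (m_inv (tensor_alg 2) Q)"
proof -
  interpret M: monoid "tensor_alg 2" by (rule monoid_tensor_alg)
  let ?T = "m_inv (tensor_alg 2) Q"
  have car: "Q \<in> tensor_power 2" "?T \<in> tensor_power 2"
    using assms M.Units_closed M.Units_inv_closed by (auto simp: tensor_alg_def)
  then obtain p q where pq: "Q = tclass p" "?T = tclass q"
    using tensor_power_tclass by blast
  have one: "\<one>\<^bsub>tensor_alg 2\<^esub> = pure [1, 1]" "mult (tensor_alg 2) = (\<bullet>)"
    by (simp_all add: tensor_alg_def numeral_2_eq_2)
  have "flip ?T \<bullet> flip Q = pure [1, 1]" "flip Q \<bullet> flip ?T = pure [1, 1]"
    using M.Units_l_inv[OF assms] M.Units_r_inv[OF assms]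
    unfolding one by (metis pq flip_tmult flip_one)+
  then show ?thesis
    using M.inv_unique'[of "flip Q" "flip ?T"] flip_closed[OF car(1)] flip_closed[OF car(2)]
    unfolding one by (simp add: tensor_alg_def)
qed

lemma lift_mult_left: "c * lift f t = lift (\<lambda>w. c * f w) t"
  by (simp add: lift_def lin_ext_def sum_distrib_left scale_mult_right)

end

section \<open>Uniqueness of the \<open>u\<close>-operator\<close>

lemma monoid_mult_monoid: "monoid mult_monoid"
  by unfold_locales (simp_all add: mult_monoid_def mult.assoc)

lemma mult_monoid_inv:
  assumes "u \<in> Units mult_monoid"
  shows "m_inv mult_monoid u * u = 1" "u * m_inv mult_monoid u = 1"
  using monoid.Units_l_inv[OF monoid_mult_monoid assms] monoid.Units_r_inv[OF monoid_mult_monoid assms]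
  by (simp_all add: mult_monoid_def)

context quasi_Hopf_algebra
begin

lemma S_inv_S [simp]: "S (inv S a) = a"
  by (meson S_bij bij_is_surj surj_f_inv_f)

lemma inv_S_S [simp]: "inv S (S a) = a"
  by (meson S_bij bij_is_inj inv_f_f)

lemma S_eq_iff: "S a = S b \<longleftrightarrow> a = b"
  by (metis inv_S_S)

lemma S_zero: "S 0 = 0"
  using S_add[of 0 0] by simp

lemma S_sum: "S (sum f A) = (\<Sum>a\<in>A. S (f a))"
  by (induction A rule: infinite_finite_induct) (simp_all add: S_zero S_add)

text \<open>
  A central factor can be moved next to \<open>\<beta>\<close> in each summand of
  \<open>\<Sum> S(X\<^sub>\<nu>) \<alpha> Y\<^sub>\<nu> \<beta> S(Z\<^sub>\<nu>) = 1\<close>. Thus a central element that fixes \<open>\<beta>\<close> fixes this sum.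
\<close>

lemma central_eq_one:
  assumes central: "\<And>a. c * a = a * c" and "c * \<beta> = \<beta>"
  shows "c = 1"
proof -
  have "c * (S x * \<alpha> * y * \<beta> * S z) = S x * \<alpha> * y * \<beta> * S z" for x y z
    by (metis assms mult.assoc)
  then have "c * lift3 (\<lambda>x y z. S x * \<alpha> * y * \<beta> * S z) \<Phi> =
      lift3 (\<lambda>x y z. S x * \<alpha> * y * \<beta> * S z) \<Phi>"
    unfolding lift3_def lift_mult_left
    by (intro arg_cong2[where f = lift] ext refl) (auto split: list.splits)
  then show ?thesis
    by (simp add: S_alpha_beta)
qed

text \<open>
  The quotient \<open>v\<^sup>-\<^sup>1 u\<close> of two elements that implement \<open>S\<^sup>2\<close> is central. The element \<open>b\<close> stands
  for \<open>\<beta>\<^sub>Q\<close>; it forces \<open>S\<close> of the quotient to fix \<open>\<beta>\<close>.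
\<close>

lemma u_operator_eqI:
  assumes v: "v' * v = 1" "v * v' = 1"
    and Su: "\<And>a. S (S a) * u = u * a" and Sv: "\<And>a. S (S a) * v = v * a"
    and u: "b * u = inv S \<beta>" and bv: "b * v = inv S \<beta>"
  shows "u = v"
proof -
  define c where "c = v' * u"
  have u_eq: "u = v * c"
    by (simp add: c_def mult.assoc[symmetric] v)
  have central: "c * a = a * c" for a
  proof -
    have "v * (c * a) = S (S a) * (v * c)"
      by (simp add: mult.assoc[symmetric] u_eq[symmetric] Su)
    also have "\<dots> = v * (a * c)"
      by (simp add: mult.assoc[symmetric] Sv)
    finally have "v' * v * (c * a) = v' * v * (a * c)"
      by (simp add: mult.assoc)
    then show ?thesis by (simp add: v)
  qed
  have "S c = 1"
  proof (rule central_eq_one)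
    fix a
    show "S c * a = a * S c"
      using central[of "inv S a"] by (metis S_inv_S S_mult)
    have "inv S \<beta> * c = inv S \<beta>"
      using u bv by (simp add: u_eq mult.assoc[symmetric])
    then show "S c * \<beta> = \<beta>"
      by (metis S_inv_S S_mult)
  qed
  then have "c = 1"
    by (metis S_one S_eq_iff)
  then show ?thesis by (simp add: u_eq)
qed

section \<open>The \<open>u\<close>-operator of the transposed inverse\<close>

lemma multilinear_case2:
  assumes "\<And>x x' y. f (x + x') y = f x y + f x' y" "\<And>x y y'. f x (y + y') = f x y + f x y'"
    and "\<And>c x y. f (scale c x) y = scale c (f x y)" "\<And>c x y. f x (scale c y) = scale c (f x y)"
  shows "multilinear scale (\<lambda>w. case w of [x, y] \<Rightarrow> f x y | _ \<Rightarrow> 0)"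
  unfolding multilinear_def
  by (auto simp: assms Cons_eq_append_conv append_eq_Cons_conv split: list.splits)

lemma lift2_tclass:
  assumes "\<And>x x' y. f (x + x') y = f x y + f x' y" "\<And>x y y'. f x (y + y') = f x y + f x y'"
    and "\<And>c x y. f (scale c x) y = scale c (f x y)" "\<And>c x y. f x (scale c y) = scale c (f x y)"
  shows "lift2 f (tclass p) = lin_ext scale (\<lambda>w. case w of [x, y] \<Rightarrow> f x y | _ \<Rightarrow> 0) p"
  unfolding lift2_def by (rule lift_tclass, rule multilinear_case2) (fact assms)+

lemma lift2_beta_tclass:
  "lift2 (\<lambda>x y. x * b * S y) (tclass p) =
     lin_ext scale (\<lambda>w. case w of [x, y] \<Rightarrow> x * b * S y | _ \<Rightarrow> 0) p"
  by (rule lift2_tclass)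
    (simp_all add: S_add S_scale distrib_left distrib_right scale_mult_left scale_mult_right)

text \<open>
  Since \<open>S\<close> reverses products, \<open>x (x' \<beta> S(y')) S(y) = (x x') \<beta> S(y y')\<close>. So sandwiching \<open>\<beta>\<^sub>Q\<close>
  by a tensor \<open>T\<close> amounts to sandwiching \<open>\<beta>\<close> by the product \<open>T Q\<close>.
\<close>

lemma lift2_beta_op:
  "lift2 (\<lambda>x y. x * beta_op (tclass q) * S y) (tclass p) = beta_op (tclass p \<bullet> tclass q)"
proof -
  let ?f = "\<lambda>w. case w of [x, y] \<Rightarrow> x * \<beta> * S y | _ \<Rightarrow> 0"
  have "(case v of [x, y] \<Rightarrow> x * lin_ext scale ?f q * S y | _ \<Rightarrow> 0) =
      lin_ext scale (\<lambda>w. if length v = length w then ?f (map2 (*) v w) else 0) q" for v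
  proof (cases "length v = 2")
    case True
    then obtain x y where v: "v = [x, y]"
      by (auto simp: numeral_2_eq_2 length_Suc_conv)
    have "x * ?f w * S y = (if length v = length w then ?f (map2 (*) v w) else 0)" for w
      by (auto simp: v S_mult mult.assoc split: list.splits)
    then show ?thesis
      by (simp add: v lin_ext_def sum_distrib_left sum_distrib_right
          scale_mult_left scale_mult_right)
  next
    case False
    then have "(if length v = length w then ?f (map2 (*) v w) else 0) = 0" for w
      by (auto split: list.splits dest: arg_cong[where f = length])
    with False show ?thesis
      by (auto simp: lin_ext_def split: list.splits)
  qed
  then show ?thesis
    unfolding beta_op_def tmult_tclass lift2_beta_tclass
      lin_ext_free_mult[OF vector_space_axioms] by (intro lin_ext_cong)
qed

text \<open>
  With \<open>T = Q\<^sup>-\<^sup>1\<close> and \<open>u' = u\<^sup>-\<^sup>1\<close>, this is the condition on \<open>\<beta>\<close> for \<open>S(u\<^sup>-\<^sup>1)\<close>. After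
  \<open>S\<^sup>-\<^sup>1(\<beta>)\<close> has been replaced by \<open>\<beta>\<^sub>Q u\<close> in each summand, the sum over \<open>T\<close> sandwiches \<open>\<beta>\<^sub>Q\<close>,
  and \<open>T\<close> and \<open>Q\<close> cancel by \<open>lift2_beta_op\<close>.
\<close>

lemma beta_op_flip:
  assumes u: "beta_op Q * u = inv S \<beta>" "u' * u = 1" "u * u' = 1" "\<And>a. S (S a) * u = u * a"
    and Q: "Q \<in> tensor_power 2" "T \<in> tensor_power 2" "T \<bullet> Q = pure [1, 1]"
  shows "beta_op (flip T) * S u' = inv S \<beta>"
proof -
  obtain p q where pq: "Q = tclass q" "T = tclass p"
    using Q tensor_power_tclass by blast
  let ?f = "\<lambda>w. case w of [x, y] \<Rightarrow> x * \<beta> * S y | _ \<Rightarrow> 0"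
  let ?g = "\<lambda>w. case w of [x, y] \<Rightarrow> x * beta_op Q * S y | _ \<Rightarrow> 0"
  have summand: "y * \<beta> * S x * S u' = S (u' * (x * beta_op Q * S y) * u)" for x y
  proof -
    have "S (u' * (x * beta_op Q * S y) * u) = S (u' * (x * beta_op Q * (S y * u)))"
      by (simp add: mult.assoc)
    also have "S y * u = u * inv S y"
      using u(4)[of "inv S y"] by simp
    also have "S (u' * (x * beta_op Q * (u * inv S y))) = S (u' * (x * inv S \<beta> * inv S y))"
      by (metis u(1) mult.assoc)
    finally show ?thesis
      by (simp add: S_mult mult.assoc)
  qed
  have "beta_op (flip T) * S u' = lin_ext scale (\<lambda>w. lin_ext scale ?f (word_flip w)) p * S u'"
    by (simp add: beta_op_def pq flip_tclass lift2_beta_tclass lin_ext_lin_ext[OF vector_space_axioms])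
  also have "\<dots> = lin_ext scale (\<lambda>w. S (u' * ?g w * u)) p"
    unfolding lin_ext_def[of _ _ p] sum_distrib_right
    by (intro sum.cong refl)
      (auto simp: scale_mult_left word_flip_def lin_ext_def S_zero summand split: list.splits)
  also have "\<dots> = S (u' * lin_ext scale ?g p * u)"
    by (simp add: lin_ext_def sum_distrib_left sum_distrib_right S_sum
        scale_mult_left scale_mult_right S_scale)
  also have "lin_ext scale ?g p = beta_op (T \<bullet> Q)"
    using lift2_beta_op[of q p] unfolding pq lift2_beta_tclass .
  also have "beta_op (T \<bullet> Q) = \<beta>"
    unfolding Q(3) beta_op_def pure_def lift2_beta_tclass by (simp add: S_one)
  also have "u' * \<beta> * u = inv S (inv S \<beta>)"
    using u(4)[of "inv S (inv S \<beta>)"] by (simp add: mult.assoc) (simp add: mult.assoc[symmetric] u)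
  finally show ?thesis
    by simp
qed

lemma is_u_operatorD:
  assumes "is_u_operator Q u"
  shows "m_inv mult_monoid u * u = 1" "u * m_inv mult_monoid u = 1"
    "S (S a) * u = u * a" "beta_op Q * u = inv S \<beta>"
proof -
  show u: "m_inv mult_monoid u * u = 1" "u * m_inv mult_monoid u = 1"
    using assms by (auto simp: is_u_operator_def mult_monoid_inv)
  show "beta_op Q * u = inv S \<beta>"
    using assms by (simp add: is_u_operator_def)
  have "S (S a) = u * a * m_inv mult_monoid u"
    using assms by (simp add: is_u_operator_def)
  then show "S (S a) * u = u * a"
    by (simp add: mult.assoc u)
qed

lemma u_operator_tilde:
  assumes Q: "Q \<in> Units (tensor_alg 2)"
    and u: "is_u_operator Q u" and u': "is_u_operator (tilde Q) u'"
  shows "u' = S (m_inv mult_monoid u)"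
proof -
  let ?v = "m_inv mult_monoid u" and ?T = "m_inv (tensor_alg 2) Q"
  interpret M: monoid "tensor_alg 2" by (rule monoid_tensor_alg)
  have T: "Q \<in> tensor_power 2" "?T \<in> tensor_power 2" "?T \<bullet> Q = pure [1, 1]"
    using M.Units_closed[OF Q] M.Units_inv_closed[OF Q] M.Units_l_inv[OF Q]
    by (simp_all add: tensor_alg_def numeral_2_eq_2)
  note D = is_u_operatorD[OF u] and D' = is_u_operatorD[OF u']
  have inv: "S u * S ?v = 1" "S ?v * S u = 1"
    by (simp_all add: S_mult[symmetric] D S_one)
  have conj: "S (S a) * S ?v = S ?v * a" for a
  proof -
    \<comment> \<open>The identity \<open>u\<^sup>-\<^sup>1 S\<^sup>2(b) = b u\<^sup>-\<^sup>1\<close> at \<open>b = S\<^sup>-\<^sup>1(a)\<close>, to which \<open>S\<close> is then applied.\<close>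
    have "?v * S (S (inv S a)) * (u * ?v) = ?v * u * inv S a * ?v"
      by (metis D(3) mult.assoc)
    then have "S (?v * S a) = S (inv S a * ?v)"
      by (simp add: D)
    then show ?thesis
      by (simp add: S_mult)
  qed
  have "beta_op (tilde Q) * S ?v = inv S \<beta>"
    unfolding tilde_def inv_flip[OF Q]
    by (rule beta_op_flip[OF D(4,1,2,3) T])
  then show ?thesis
    by (intro u_operator_eqI[OF inv D'(3) conj D'(4)])
qed

end

theorem lemma2:
  fixes scale :: "'k::field \<Rightarrow> 'h::ring_1 \<Rightarrow> 'h"
  assumes "quasi_triangular_quasi_Hopf_algebra scale \<Delta> \<epsilon> \<Phi> S \<alpha> \<beta> \<R>"
    and "quasi_Hopf_algebra.is_u_operator scale S \<alpha> \<beta> \<R> u"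
    and "quasi_Hopf_algebra.is_u_operator scale S \<alpha> \<beta> (quasi_Hopf_algebra.tilde scale \<R>) u'"
  shows "u' = S (m_inv mult_monoid u)"
proof -
  interpret quasi_triangular_quasi_Hopf_algebra scale \<Delta> \<epsilon> \<Phi> S \<alpha> \<beta> \<R>
    by (fact assms(1))
  show ?thesis
    using R_matrix_R assms(2,3) by (intro u_operator_tilde) (auto simp: R_matrix_def)
qed

end
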